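(* Let $\mathcal{T}(\{\alpha_n\})$ and $\mathcal{T}(\{\beta_n\})$ be truncated CMV matrices (both semi-infinite or both $N\times N$). Then $\mathcal{T}(\{\alpha_n\})$ and $\mathcal{T}(\{\beta_n\})$ are unitarily equivalent if and only if there is $t\in[0,2\pi)$ such that $\beta_n=e^{it}\alpha_n$ for all $n$. Moreover, if $\mathcal{V}$ is the diagonal unitary matrix $\mathcal{V}=\mathrm{diag}(e^{it},1,e^{it},1,\ldots)$, then $$\mathcal{V}\,\mathcal{T}(\{\alpha_n\})\,\mathcal{V}^{-1}=\mathcal{T}(\{e^{it}\alpha_n\}).$$
   Context: Truncated CMV matrices. Let $\mathbb{D}$ be the open unit disk. Let $\{\alpha_n\}_{n\ge0}\subset\mathbb{D}$ be infinite (semi-infinite case), or $\alpha_0,\dots,\alpha_{N-1}\in\mathbb{D}$, $|\alpha_N|=1$ ($N\times N$ case); $\rho_n=\sqrt{1-|\alpha_n|^2}$. The truncated CMV matrix $\mathcal{T}(\{\alpha_n\})=(t_{ij})$, with $i,j\in\mathbb{N}$ or $1\le i,j\le N$ respectively, has entries $t_{m,m}=-\bar\alpha_m\alpha_{m-1}$; for $m$ odd: $t_{m+1,m}=\bar\alpha_{m+1}\rho_m$, $t_{m,m+1}=-\alpha_{m-1}\rho_m$, $t_{m+2,m}=\rho_m\rho_{m+1}$, $t_{m,m+2}=0$; for $m$ even: $t_{m+1,m}=-\alpha_{m-1}\rho_m$, $t_{m,m+1}=\bar\alpha_{m+1}\rho_m$, $t_{m+2,m}=0$, $t_{m,m+2}=\rho_m\rho_{m+1}$;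 all other entries are $0$. It acts as a bounded operator on $\ell^2(\mathbb{N})$ or on $\mathbb{C}^N$. *)

theory Defs
  imports "HOL-Analysis.Analysis" "HOL-Library.Extended_Nat"
begin

text \<open>
  The size \<open>N\<close> of a matrix is an extended natural number: \<open>N = \<infinity>\<close> is the semi-infinite case.
  Rows and columns are numbered from 1, the parameters \<open>\<alpha>\<close> from 0 up to and including \<open>N\<close>.
  Only the values \<open>\<alpha> n\<close> with \<open>enat n \<le> N\<close> and the entries with both indices in \<open>idx N\<close> matter.
\<close>

definition idx :: "enat \<Rightarrow> nat set" where
  "idx N = {i. 1 \<le> i \<and> enat i \<le> N}"

definition cmv_params :: "enat \<Rightarrow> (nat \<Rightarrow> complex) \<Rightarrow> bool" where
  "cmv_params N \<alpha> \<longleftrightarrow>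
     (\<forall>n. enat n < N \<longrightarrow> cmod (\<alpha> n) < 1) \<and> (\<forall>n. enat n = N \<longrightarrow> cmod (\<alpha> n) = 1)"

definition rho :: "(nat \<Rightarrow> complex) \<Rightarrow> nat \<Rightarrow> complex" where
  "rho \<alpha> n = complex_of_real (sqrt (1 - (cmod (\<alpha> n))\<^sup>2))"

definition truncated_cmv :: "(nat \<Rightarrow> complex) \<Rightarrow> nat \<Rightarrow> nat \<Rightarrow> complex" where
  "truncated_cmv \<alpha> i j =
    (if i = j then - cnj (\<alpha> i) * \<alpha> (i - 1)
     else if i = j + 1 then
       (if odd j then cnj (\<alpha> (j + 1)) * rho \<alpha> j else - \<alpha> (j - 1) * rho \<alpha> j)
     else if j = i + 1 then
       (if odd i then - \<alpha> (i - 1) * rho \<alpha> i else cnj (\<alpha> (i + 1)) * rho \<alpha> i)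
     else if i = j + 2 then (if odd j then rho \<alpha> j * rho \<alpha> (j + 1) else 0)
     else if j = i + 2 then (if odd i then 0 else rho \<alpha> i * rho \<alpha> (i + 1))
     else 0)"

definition diag_V :: "real \<Rightarrow> nat \<Rightarrow> nat \<Rightarrow> complex" where
  "diag_V t i j = (if i = j then (if odd i then cis t else 1) else 0)"

text \<open>
  \<open>ell2 N\<close> is \<open>\<ell>\<^sup>2(\<nat>)\<close> for \<open>N = \<infinity>\<close> and \<open>\<complex>\<^sup>N\<close> for finite \<open>N\<close>, its elements being functions
  extended by 0 outside \<open>idx N\<close>, so that equality of functions is equality of vectors.
\<close>

definition ell2 :: "enat \<Rightarrow> (nat \<Rightarrow> complex) set" where
  "ell2 N = {x. (\<forall>i. i \<notin> idx N \<longrightarrow> x i = 0) \<and> (\<lambda>i. (cmod (x i))\<^sup>2) summable_on idx N}"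

definition ell2_inner :: "enat \<Rightarrow> (nat \<Rightarrow> complex) \<Rightarrow> (nat \<Rightarrow> complex) \<Rightarrow> complex" where
  "ell2_inner N x y = (\<Sum>\<^sub>\<infinity>i\<in>idx N. x i * cnj (y i))"

definition mat_op ::
    "enat \<Rightarrow> (nat \<Rightarrow> nat \<Rightarrow> complex) \<Rightarrow> (nat \<Rightarrow> complex) \<Rightarrow> nat \<Rightarrow> complex" where
  "mat_op N A x = (\<lambda>i. if i \<in> idx N then (\<Sum>\<^sub>\<infinity>j\<in>idx N. A i j * x j) else 0)"

definition unitary_op :: "enat \<Rightarrow> ((nat \<Rightarrow> complex) \<Rightarrow> nat \<Rightarrow> complex) \<Rightarrow> bool" where
  "unitary_op N U \<longleftrightarrow>
     bij_betw U (ell2 N) (ell2 N) \<and>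
     (\<forall>x\<in>ell2 N. \<forall>y\<in>ell2 N. \<forall>a b. U (\<lambda>i. a * x i + b * y i) = (\<lambda>i. a * U x i + b * U y i)) \<and>
     (\<forall>x\<in>ell2 N. \<forall>y\<in>ell2 N. ell2_inner N (U x) (U y) = ell2_inner N x y)"

definition unitarily_equivalent ::
    "enat \<Rightarrow> (nat \<Rightarrow> nat \<Rightarrow> complex) \<Rightarrow> (nat \<Rightarrow> nat \<Rightarrow> complex) \<Rightarrow> bool" where
  "unitarily_equivalent N A B \<longleftrightarrow>
     (\<exists>U. unitary_op N U \<and>
        (\<forall>x\<in>ell2 N. U (mat_op N A (inv_into (ell2 N) U x)) = mat_op N B x))"

end

theory Submission imports Defs
begin

text \<open>
  A truncated CMV matrix factors as \<open>T = L M\<close>, where \<open>M\<close> is the direct sum of the \<open>2 \<times> 2\<close> blocks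
  \<open>\<Theta>\<^sub>n\<close> with rows \<open>(cnj \<alpha>\<^sub>n, \<rho>\<^sub>n)\<close> and \<open>(\<rho>\<^sub>n, - \<alpha>\<^sub>n)\<close> for odd \<open>n\<close>, placed at the coordinates \<open>n, n + 1\<close>,
  and \<open>L\<close> is the sum of the scalar \<open>- \<alpha>\<^sub>0\<close> at coordinate 1 and of the blocks with even \<open>n \<ge> 2\<close>. All
  blocks are unitary (for finite \<open>N\<close> the last one is cut down to a unimodular scalar, as
  \<open>\<rho>\<^sub>N = 0\<close>), so \<open>M\<close> is unitary, and \<open>L\<close> is unitary except for the factor \<open>- \<alpha>\<^sub>0\<close>. Hence \<open>T\<close>
  is a contraction whose two defects have rank one: with \<open>g = M\<^sup>* e\<^sub>1 = \<alpha>\<^sub>1 e\<^sub>1 + \<rho>\<^sub>1 e\<^sub>2\<close>, the operator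
  \<open>T T\<^sup>*\<close> multiplies \<open>e\<^sub>1\<close> by \<open>\<bar>\<alpha>\<^sub>0\<bar>\<^sup>2 < 1\<close> and is the identity on the orthogonal complement of \<open>e\<^sub>1\<close>, and
  \<open>T\<^sup>* T\<close> does the same with \<open>g\<close>.

  A unitary \<open>U\<close> with \<open>U T\<^sub>\<alpha> = T\<^sub>\<beta> U\<close> also intertwines the adjoints, hence both products, and so maps
  the defect vectors to multiples of the defect vectors: \<open>U e\<^sub>1 = c e\<^sub>1\<close> and
  \<open>U g\<^sub>\<alpha> = c' g\<^sub>\<beta>\<close> with unimodular \<open>c, c'\<close> (\<open>intertwiner_maps_defect_vectors\<close>). The quotient
  \<open>\<mu> = c / c'\<close> is the rotation that is sought. Conjugation with \<open>diag (\<mu>, 1, \<mu>, 1, \<dots>)\<close> multiplies all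
  parameters by \<open>\<mu>\<close> (\<open>twist_double_layer\<close>), so undoing this rotation on the side of \<open>\<beta>\<close> reduces
  everything to \<open>c = c' = 1\<close>.

  In that case \<open>U\<close> fixes every basis vector, and this forces the parameters to agree
  (\<open>rigidity\<close>). The equation \<open>T g = - \<alpha>\<^sub>0 e\<^sub>1\<close> gives \<open>\<alpha>\<^sub>0 = \<beta>\<^sub>0\<close>, the vector \<open>g\<close> gives \<open>\<alpha>\<^sub>1 = \<beta>\<^sub>1\<close> and then \<open>U e\<^sub>2 = e\<^sub>2\<close>. Afterwards
  one alternates between \<open>T\<close> and \<open>T\<^sup>*\<close>: if \<open>U\<close> fixes \<open>e\<^sub>1, \<dots>, e\<^sub>k\<close> and the parameters below \<open>k\<close> agree,
  then \<open>T e\<^sub>k\<^sub>-\<^sub>1\<close> for even \<open>k\<close>, or \<open>T\<^sup>* e\<^sub>k\<^sub>-\<^sub>1\<close> for odd \<open>k\<close>, is a combination of \<open>e\<^sub>1, \<dots>, e\<^sub>k\<^sub>+\<^sub>1\<close> in which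
  only the coefficients of \<open>e\<^sub>k\<close> and \<open>e\<^sub>k\<^sub>+\<^sub>1\<close> involve \<open>\<alpha>\<^sub>k\<close>. Reading off the first gives \<open>\<alpha>\<^sub>k = \<beta>\<^sub>k\<close>, and as
  the second is nonzero for \<open>k < N\<close>, \<open>U\<close> fixes \<open>e\<^sub>k\<^sub>+\<^sub>1\<close> too.
\<close>

section \<open>Square-summable sequences supported on the index set\<close>

text \<open>
  Elements of \<open>ell2 N\<close> vanish off the index set, so both sizes, finite and infinite, can be treated
  as series over all natural numbers.
\<close>

lemma ell2_iff:
  "x \<in> ell2 N \<longleftrightarrow> (\<forall>i. i \<notin> idx N \<longrightarrow> x i = 0) \<and> summable (\<lambda>i. (cmod (x i))\<^sup>2)"
proof -
  have "(\<lambda>i. (cmod (x i))\<^sup>2) summable_on idx N \<longleftrightarrow> (\<lambda>i. (cmod (x i))\<^sup>2) summable_on UNIV"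
    if "\<forall>i. i \<notin> idx N \<longrightarrow> x i = 0"
    by (rule summable_on_cong_neutral) (use that in auto)
  then show ?thesis
    by (auto simp: ell2_def summable_on_UNIV_nonneg_real_iff)
qed

lemma ell2_zero: "x \<in> ell2 N \<Longrightarrow> i \<notin> idx N \<Longrightarrow> x i = 0"
  by (simp add: ell2_def)

lemma ell2_zero_0 [simp]: "x \<in> ell2 N \<Longrightarrow> x 0 = 0"
  by (simp add: ell2_def idx_def)

lemma cmod_add_power2_le: "(cmod (a + b))\<^sup>2 \<le> 2 * (cmod a)\<^sup>2 + 2 * (cmod b)\<^sup>2"
proof -
  have "(cmod (a + b))\<^sup>2 \<le> (cmod a + cmod b)\<^sup>2"
    by (intro power_mono norm_triangle_ineq) auto
  also have "\<dots> \<le> 2 * (cmod a)\<^sup>2 + 2 * (cmod b)\<^sup>2"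
    using sum_squares_bound[of "cmod a" "cmod b"] by (simp add: power2_sum)
  finally show ?thesis .
qed

lemma cmod_combination_power2_le:
  assumes "cmod a \<le> 1" "cmod b \<le> 1"
  shows "(cmod (a * u + b * v))\<^sup>2 \<le> 2 * (cmod u)\<^sup>2 + 2 * (cmod v)\<^sup>2"
proof -
  have "(cmod (a * u))\<^sup>2 \<le> (cmod u)\<^sup>2" "(cmod (b * v))\<^sup>2 \<le> (cmod v)\<^sup>2"
    using assms by (auto simp: norm_mult intro!: power_mono mult_left_le_one_le)
  then show ?thesis
    using cmod_add_power2_le[of "a * u" "b * v"] by linarith
qed

lemma ell2_scale: "x \<in> ell2 N \<Longrightarrow> (\<lambda>i. a * x i) \<in> ell2 N"
  by (auto simp: ell2_iff norm_mult power_mult_distrib intro: summable_mult)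

lemma ell2_add:
  assumes "x \<in> ell2 N" "y \<in> ell2 N"
  shows "(\<lambda>i. x i + y i) \<in> ell2 N"
proof -
  have "summable (\<lambda>i. 2 * (cmod (x i))\<^sup>2 + 2 * (cmod (y i))\<^sup>2)"
    using assms by (auto simp: ell2_iff intro!: summable_add summable_mult)
  then have "summable (\<lambda>i. (cmod (x i + y i))\<^sup>2)"
    by (rule summable_comparison_test'[where N = 0]) (use cmod_add_power2_le in auto)
  then show ?thesis
    using assms by (auto simp: ell2_iff)
qed

lemma ell2_lincomb:
  "x \<in> ell2 N \<Longrightarrow> y \<in> ell2 N \<Longrightarrow> (\<lambda>i. a * x i + b * y i) \<in> ell2 N"
  by (intro ell2_add ell2_scale)

lemma ell2_inner_sums:
  assumes "x \<in> ell2 N" "y \<in> ell2 N"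
  shows "(\<lambda>i. x i * cnj (y i)) sums ell2_inner N x y"
proof -
  have s: "summable (\<lambda>i. (cmod (x i))\<^sup>2 + (cmod (y i))\<^sup>2)"
    using assms by (auto simp: ell2_iff intro!: summable_add)
  have "cmod (x i) * cmod (y i) \<le> (cmod (x i))\<^sup>2 + (cmod (y i))\<^sup>2" for i
    using sum_squares_bound[of "cmod (x i)" "cmod (y i)", unfolded mult.assoc]
      mult_nonneg_nonneg[of "cmod (x i)" "cmod (y i)"] by (smt (verit) norm_ge_zero)
  then have "summable (\<lambda>i. norm (x i * cnj (y i)))"
    by (intro summable_comparison_test'[where N = 0, OF s]) (auto simp: norm_mult)
  then have "(\<lambda>i. x i * cnj (y i)) summable_on UNIV"
    by (rule norm_summable_imp_summable_on)
  then have "(\<lambda>i. x i * cnj (y i)) sums infsum (\<lambda>i. x i * cnj (y i)) UNIV"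
    by (intro has_sum_imp_sums has_sum_infsum)
  also have "infsum (\<lambda>i. x i * cnj (y i)) UNIV = ell2_inner N x y"
    unfolding ell2_inner_def
    by (rule infsum_cong_neutral) (use ell2_zero[OF assms(1)] in auto)
  finally show ?thesis .
qed

text \<open>
  The vectors \<open>e\<^sub>k\<close>, with \<open>e\<^sub>0 = 0\<close>: this makes the formulas for neighbouring vectors hold at the
  edge of the index set, where there is no coordinate 0.
\<close>

definition basis :: "nat \<Rightarrow> nat \<Rightarrow> complex" where
  "basis k i = (if i = k \<and> 0 < k then 1 else 0)"

lemma basis_0 [simp]: "basis 0 = (\<lambda>i. 0)"
  by (auto simp: basis_def)

lemma basis_ell2: 
  assumes "enat k \<le> N"
  shows "basis k \<in> ell2 N"
proof -
  have "summable (\<lambda>i. (cmod (basis k i))\<^sup>2)"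
    by (rule summable_finite[of "{k}"]) (auto simp: basis_def)
  with assms show ?thesis
    by (auto simp: ell2_iff idx_def basis_def)
qed

lemma ell2_inner_basis:
  assumes "x \<in> ell2 N" "k \<in> idx N"
  shows "ell2_inner N x (basis k) = x k"
proof -
  have b: "basis k \<in> ell2 N"
    using assms by (auto simp: idx_def intro: basis_ell2)
  have "(\<lambda>i. x i * cnj (basis k i)) sums (\<Sum>i\<in>{k}. x i * cnj (basis k i))"
    by (rule sums_finite) (auto simp: basis_def)
  moreover have "(\<Sum>i\<in>{k}. x i * cnj (basis k i)) = x k"
    using assms by (auto simp: basis_def idx_def)
  ultimately show ?thesis
    using ell2_inner_sums[OF assms(1) b] sums_unique2 by metis
qed

section \<open>The two layers\<close>

text \<open>
  The operators \<open>M\<close> (for \<open>p = True\<close>) and \<open>L\<close> (for \<open>p = False\<close>): a block \<open>\<Theta>\<^sub>n\<close> acts on the coordinates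
  \<open>n, n + 1\<close> for every \<open>n \<ge> 1\<close> of the parity \<open>p\<close>. On arguments with \<open>x 0 = 0\<close>, the last line gives
  \<open>- \<alpha> 0 * x 1\<close> at coordinate 1 when \<open>p\<close> is false, the only trace left of the block \<open>\<Theta>\<^sub>0\<close>.
\<close>

definition layer :: "bool \<Rightarrow> (nat \<Rightarrow> complex) \<Rightarrow> (nat \<Rightarrow> complex) \<Rightarrow> nat \<Rightarrow> complex" where
  "layer p \<alpha> x i =
     (if i = 0 then 0
      else if odd i = p then cnj (\<alpha> i) * x i + rho \<alpha> i * x (Suc i)
      else rho \<alpha> (i - 1) * x (i - 1) - \<alpha> (i - 1) * x i)"

lemma rho_cnj [simp]: "rho (\<lambda>n. cnj (\<alpha> n)) = rho \<alpha>"
  by (simp add: rho_def fun_eq_iff)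

lemma cnj_rho [simp]: "cnj (rho \<alpha> n) = rho \<alpha> n"
  by (simp add: rho_def)

lemma cmv_params_cnj: "cmv_params N \<alpha> \<Longrightarrow> cmv_params N (\<lambda>n. cnj (\<alpha> n))"
  by (simp add: cmv_params_def)

lemma cmv_params_le: "cmv_params N \<alpha> \<Longrightarrow> enat n \<le> N \<Longrightarrow> cmod (\<alpha> n) \<le> 1"
  by (auto simp: cmv_params_def le_less)

lemma rho_sq:
  assumes "cmv_params N \<alpha>" "enat n \<le> N"
  shows "rho \<alpha> n * rho \<alpha> n = 1 - \<alpha> n * cnj (\<alpha> n)"
proof -
  have "(cmod (\<alpha> n))\<^sup>2 \<le> 1"
    using cmv_params_le[OF assms] by (simp add: power_le_one_iff)
  then have "rho \<alpha> n * rho \<alpha> n = complex_of_real (1 - (cmod (\<alpha> n))\<^sup>2)"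
    unfolding rho_def of_real_mult[symmetric] by simp
  then show ?thesis
    by (simp only: of_real_diff of_real_1 complex_norm_square)
qed

lemma cmod_rho_le: 
  assumes "cmv_params N \<alpha>" "enat n \<le> N"
  shows "cmod (rho \<alpha> n) \<le> 1"
proof -
  have "(cmod (\<alpha> n))\<^sup>2 \<le> 1"
    using cmv_params_le[OF assms] by (simp add: power_le_one_iff)
  then show ?thesis
    by (simp add: rho_def)
qed

lemma rho_last: "cmv_params N \<alpha> \<Longrightarrow> enat n = N \<Longrightarrow> rho \<alpha> n = 0"
  by (simp add: rho_def cmv_params_def)

lemma rho_nonzero:
  assumes "cmv_params N \<alpha>" "enat n < N"
  shows "rho \<alpha> n \<noteq> 0"
proof -
  have "(cmod (\<alpha> n))\<^sup>2 < 1"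
    using assms by (simp add: cmv_params_def power_less_one_iff abs_square_less_1)
  then show ?thesis
    by (simp add: rho_def)
qed

text \<open>
  For finite \<open>N\<close> a block may straddle the coordinates \<open>N, N + 1\<close>. Its off-diagonal entry is
  \<open>\<rho>\<^sub>N = 0\<close>, so nothing leaks out of the index set.
\<close>

lemma layer_outside:
  assumes \<alpha>: "cmv_params N \<alpha>" and x: "x \<in> ell2 N" and i: "i \<notin> idx N"
  shows "layer p \<alpha> x i = 0"
proof (cases "i = 0")
  case False
  then have N: "N < enat i"
    using i by (auto simp: idx_def)
  then have "N < enat (Suc i)"
    by (meson enat_ord_simps(2) lessI less_trans)
  then have *: "x i = 0" "x (Suc i) = 0"
    using i by (auto intro!: ell2_zero[OF x] simp: idx_def)
  have "rho \<alpha> (i - 1) * x (i - 1) = 0"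
  proof (cases "i - 1 \<in> idx N")
    case True
    with N have "enat (i - 1) = N"
      by (cases N) (auto simp: idx_def)
    then show ?thesis
      using rho_last[OF \<alpha>] by simp
  qed (use ell2_zero[OF x] in auto)
  with * show ?thesis
    by (simp add: layer_def)
qed (simp add: layer_def)

lemma layer_ell2:
  assumes \<alpha>: "cmv_params N \<alpha>" and x: "x \<in> ell2 N"
  shows "layer p \<alpha> x \<in> ell2 N"
proof -
  define f where "f i = (cmod (x i))\<^sup>2" for i
  have f: "summable f" "\<And>i. f i \<ge> 0"
    using x by (auto simp: ell2_iff f_def[abs_def])
  then have g: "summable (\<lambda>i. 2 * f (Suc i) + 2 * f (i - 1) + 2 * f i)"
    using summable_Suc_iff[of f] summable_Suc_iff[of "\<lambda>i. f (i - 1)"]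
    by (intro summable_add summable_mult) auto
  have "(cmod (layer p \<alpha> x i))\<^sup>2 \<le> 2 * f (Suc i) + 2 * f (i - 1) + 2 * f i" for i
  proof (cases "i \<in> idx N")
    case True
    then have n: "enat i \<le> N" "enat (i - 1) \<le> N"
      by (auto simp: idx_def intro: order_trans[rotated])
    note c = cmv_params_le[OF \<alpha>] cmod_rho_le[OF \<alpha>]
    show ?thesis
    proof (cases "i = 0 \<or> odd i \<noteq> p")
      case True
      have "(cmod (rho \<alpha> (i - 1) * x (i - 1) + - \<alpha> (i - 1) * x i))\<^sup>2 \<le> 2 * f (i - 1) + 2 * f i"
        unfolding f_def by (rule cmod_combination_power2_le) (use c[OF n(2)] in auto)
      with True show ?thesis
        using f(2)[of "Suc i"] f(2)[of "i - 1"] f(2)[of i] by (auto simp: layer_def)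
    next
      case False
      have "(cmod (cnj (\<alpha> i) * x i + rho \<alpha> i * x (Suc i)))\<^sup>2 \<le> 2 * f i + 2 * f (Suc i)"
        unfolding f_def by (rule cmod_combination_power2_le) (use c[OF n(1)] in auto)
      with False show ?thesis
        using f(2)[of "i - 1"] by (auto simp: layer_def)
    qed
  qed (use layer_outside[OF \<alpha> x] f(2) in simp)
  then have "summable (\<lambda>i. (cmod (layer p \<alpha> x i))\<^sup>2)"
    by (intro summable_comparison_test'[where N = 0, OF g]) auto
  with layer_outside[OF \<alpha> x] show ?thesis
    by (simp add: ell2_iff)
qed

text \<open>
  Conjugating the parameters of a block gives its adjoint. The sum of the differences of the two
  sides, coordinate by coordinate, telescopes: the two coordinates of a block contribute opposite
  amounts, so the partial sum up to \<open>n\<close> is zero, or is the single term \<open>h n\<close> of a block cut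
  between \<open>n\<close> and \<open>n + 1\<close>, and \<open>h\<close> tends to zero because square-summable sequences do.
\<close>

lemma layer_adjoint:
  assumes \<alpha>: "cmv_params N \<alpha>" and x: "x \<in> ell2 N" and y: "y \<in> ell2 N"
  shows "ell2_inner N (layer p \<alpha> x) y = ell2_inner N x (layer p (\<lambda>n. cnj (\<alpha> n)) y)"
proof -
  define d where "d i = layer p \<alpha> x i * cnj (y i) - x i * cnj (layer p (\<lambda>n. cnj (\<alpha> n)) y i)" for i
  define h where "h i = (if odd i = p then rho \<alpha> i * (x (Suc i) * cnj (y i) - x i * cnj (y (Suc i))) else 0)" for i
  have "d sums (ell2_inner N (layer p \<alpha> x) y - ell2_inner N x (layer p (\<lambda>n. cnj (\<alpha> n)) y))"
    unfolding d_def 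
    by (intro sums_diff ell2_inner_sums layer_ell2 cmv_params_cnj \<alpha> x y)
  moreover have "d sums 0"
  proof -
    have d: "sum d {..<Suc n} = h n" for n
    proof (induction n)
      case 0
      show ?case using x y by (simp add: d_def h_def layer_def)
    next
      case (Suc n)
      have "d (Suc n) = h (Suc n) - h n"
        by (simp add: d_def h_def layer_def algebra_simps)
      with Suc show ?case by simp
    qed
    have lim: "z \<longlonglongrightarrow> 0" if z: "z \<in> ell2 N" for z
    proof -
      have "(\<lambda>n. (cmod (z n))\<^sup>2) \<longlonglongrightarrow> 0"
        using z unfolding ell2_iff by (blast intro: summable_LIMSEQ_zero)
      then have "(\<lambda>n. sqrt ((cmod (z n))\<^sup>2)) \<longlonglongrightarrow> sqrt 0"
        by (rule tendsto_real_sqrt)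
      then show ?thesis
        by (simp add: tendsto_norm_zero_iff)
    qed
    have "(\<lambda>i. x (Suc i) * cnj (y i) - x i * cnj (y (Suc i))) \<longlonglongrightarrow> 0 * cnj 0 - 0 * cnj 0"
      by (intro tendsto_intros lim[OF x] lim[OF y] LIMSEQ_Suc)
    then have l: "(\<lambda>i. x (Suc i) * cnj (y i) - x i * cnj (y (Suc i))) \<longlonglongrightarrow> 0"
      by simp
    have "h \<longlonglongrightarrow> 0"
    proof (rule Lim_null_comparison[OF _ tendsto_norm_zero[OF l]], rule always_eventually, rule allI)
      fix i
      show "norm (h i) \<le> norm (x (Suc i) * cnj (y i) - x i * cnj (y (Suc i)))"
      proof (cases "enat i \<le> N")
        case True
        then show ?thesis
          using cmod_rho_le[OF \<alpha> True]
          by (auto simp: h_def norm_mult intro!: mult_left_le_one_le)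
      next
        case False
        then have "i \<notin> idx N"
          by (auto simp: idx_def)
        then show ?thesis
          using ell2_zero[OF x] ell2_zero[OF y] by (auto simp: h_def)
      qed
    qed
    then show ?thesis
      unfolding sums_def using d LIMSEQ_imp_Suc[of "\<lambda>n. sum d {..<n}" 0] by simp
  qed
  ultimately show ?thesis
    using sums_unique2 by fastforce
qed

text \<open>
  The blocks are unitary because \<open>\<rho>\<^sub>n\<^sup>2 + \<bar>\<alpha>\<^sub>n\<bar>\<^sup>2 = 1\<close>. The exception is the first coordinate of the even
  layer, on which the layer is the scalar \<open>- \<alpha> 0\<close>; this is where the defect of the CMV matrix
  comes from.
\<close>

lemma layer_cnj_layer:
  assumes \<alpha>: "cmv_params N \<alpha>" and x: "x \<in> ell2 N"
  shows "layer p (\<lambda>n. cnj (\<alpha> n)) (layer p \<alpha> x) =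
    (\<lambda>i. if i = 1 \<and> \<not> p then \<alpha> 0 * cnj (\<alpha> 0) * x 1 else x i)"
proof
  fix i
  show "layer p (\<lambda>n. cnj (\<alpha> n)) (layer p \<alpha> x) i =
    (if i = 1 \<and> \<not> p then \<alpha> 0 * cnj (\<alpha> 0) * x 1 else x i)"
  proof (cases "i \<in> idx N")
    case False
    then show ?thesis
      using ell2_zero[OF x False] ell2_zero[OF x, of 1] 
        layer_outside[OF cmv_params_cnj[OF \<alpha>] layer_ell2[OF \<alpha> x] False] by auto
  next
    case True
    then obtain k where k: "i = Suc k" "enat (Suc k) \<le> N"
      by (cases i) (auto simp: idx_def)
    then have k': "enat k \<le> N"
      by (meson enat_ord_simps(1) lessI less_imp_le order_trans)
    have *: "\<alpha> m * (cnj (\<alpha> m) * x i) + rho \<alpha> m * (rho \<alpha> m * x i) = x i" if "enat m \<le> N" for m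
      using rho_sq[OF \<alpha> that] by (simp add: mult.assoc[symmetric] distrib_right[symmetric])
    show ?thesis
      using k x *[OF k(2)] *[OF k'] by (cases k) (auto simp: layer_def algebra_simps)
  qed
qed

text \<open>
  Row \<open>i\<close> of the matrix is supported within distance two of \<open>i\<close>, so the claim is an identity between
  finite sums, with special shapes only for the first two rows.
\<close>

lemma truncated_cmv_eq_layers:
  assumes \<alpha>: "cmv_params N \<alpha>" and x: "x \<in> ell2 N"
  shows "mat_op N (truncated_cmv \<alpha>) x = layer False \<alpha> (layer True \<alpha> x)"
proof
  fix i
  show "mat_op N (truncated_cmv \<alpha>) x i = layer False \<alpha> (layer True \<alpha> x) i"
  proof (cases "i \<in> idx N")
    case False
    then show ?thesis
      using layer_outside[OF \<alpha> layer_ell2[OF \<alpha> x] False] by (simp add: mat_op_def)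
  next
    case True
    then obtain k where k: "i = Suc k"
      by (cases i) (auto simp: idx_def)
    \<comment> \<open>contains the coordinate 0 for \<open>k \<le> 1\<close>, which is harmless because \<open>x 0 = 0\<close>\<close>
    define F where "F = {k - 1, k, Suc k, Suc (Suc k), Suc (Suc (Suc k))}"
    have "(\<Sum>\<^sub>\<infinity>j\<in>idx N. truncated_cmv \<alpha> i j * x j) = (\<Sum>\<^sub>\<infinity>j\<in>F. truncated_cmv \<alpha> i j * x j)"
      by (rule infsum_cong_neutral)
        (use ell2_zero[OF x] in \<open>auto simp: truncated_cmv_def F_def k\<close>)
    also have "\<dots> = (\<Sum>j\<in>F. truncated_cmv \<alpha> i j * x j)"
      by (simp add: F_def)
    also have "\<dots> = layer False \<alpha> (layer True \<alpha> x) i"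
    proof (cases k)
      case 0
      then show ?thesis
        using x by (simp add: F_def truncated_cmv_def layer_def k algebra_simps)
    next
      case (Suc m)
      then show ?thesis
        using x by (cases m) (auto simp: F_def truncated_cmv_def layer_def k algebra_simps)
    qed
    finally show ?thesis
      using True by (simp add: mat_op_def)
  qed
qed

text \<open>
  \<open>double_layer True \<alpha>\<close> is the operator of the truncated CMV matrix, and \<open>double_layer False\<close> with
  conjugated parameters is its adjoint. Treating both as one family lets the alternation between
  them be written once.
\<close>

definition double_layer :: "bool \<Rightarrow> (nat \<Rightarrow> complex) \<Rightarrow> (nat \<Rightarrow> complex) \<Rightarrow> nat \<Rightarrow> complex" where
  "double_layer p \<alpha> x = layer (\<not> p) \<alpha> (layer p \<alpha> x)"

lemma double_layer_ell2:
  "cmv_params N \<alpha> \<Longrightarrow> x \<in> ell2 N \<Longrightarrow> double_layer p \<alpha> x \<in> ell2 N"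
  by (simp add: double_layer_def layer_ell2)

lemma double_layer_adjoint:
  assumes "cmv_params N \<alpha>" "x \<in> ell2 N" "y \<in> ell2 N"
  shows "ell2_inner N (double_layer p \<alpha> x) y =
    ell2_inner N x (double_layer (\<not> p) (\<lambda>n. cnj (\<alpha> n)) y)"
  using assms by (simp add: double_layer_def layer_ell2 layer_adjoint cmv_params_cnj)

lemma layer_linear:
  "layer p \<alpha> (\<lambda>i. a * x i + b * y i) = (\<lambda>i. a * layer p \<alpha> x i + b * layer p \<alpha> y i)"
  by (auto simp: layer_def algebra_simps)

lemma layer_scale: "layer p \<alpha> (\<lambda>i. a * x i) = (\<lambda>i. a * layer p \<alpha> x i)"
  using layer_linear[of p \<alpha> a x 0 x] by simp

lemma layer_basis:
  assumes "0 < j"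
  shows "layer p \<alpha> (basis j) =
    (if odd j = p then (\<lambda>i. cnj (\<alpha> j) * basis j i + rho \<alpha> j * basis (Suc j) i)
     else (\<lambda>i. rho \<alpha> (j - 1) * basis (j - 1) i - \<alpha> (j - 1) * basis j i))"
proof
  fix i
  obtain k where "j = Suc k"
    using assms by (cases j) auto
  then show "layer p \<alpha> (basis j) i =
    (if odd j = p then (\<lambda>i. cnj (\<alpha> j) * basis j i + rho \<alpha> j * basis (Suc j) i)
     else (\<lambda>i. rho \<alpha> (j - 1) * basis (j - 1) i - \<alpha> (j - 1) * basis j i)) i"
    by (cases "i = k"; cases "i = Suc k"; cases "i = Suc (Suc k)") 
       (auto simp: layer_def basis_def)
qed

text \<open>
  Only the coefficients of the last two basis vectors contain the parameter with index \<open>Suc j\<close>, and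
  no larger index occurs. This is what the inductive determination of the parameters rests on.
\<close>

lemma double_layer_basis:
  assumes "0 < j" "odd j = p"
  shows "double_layer p \<alpha> (basis j) = (\<lambda>i.
    cnj (\<alpha> j) * (rho \<alpha> (j - 1) * basis (j - 1) i - \<alpha> (j - 1) * basis j i) +
    rho \<alpha> j * (cnj (\<alpha> (Suc j)) * basis (Suc j) i + rho \<alpha> (Suc j) * basis (Suc (Suc j)) i))"
  using assms by (simp add: double_layer_def layer_basis layer_linear)

section \<open>Unitary operators\<close>

lemma unitary_ell2: "unitary_op N U \<Longrightarrow> x \<in> ell2 N \<Longrightarrow> U x \<in> ell2 N"
  by (auto simp: unitary_op_def bij_betw_def)

lemma unitary_linear:
  "unitary_op N U \<Longrightarrow> x \<in> ell2 N \<Longrightarrow> y \<in> ell2 N \<Longrightarrow>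
    U (\<lambda>i. a * x i + b * y i) = (\<lambda>i. a * U x i + b * U y i)"
  by (simp add: unitary_op_def)

lemma unitary_scale:
  "unitary_op N U \<Longrightarrow> x \<in> ell2 N \<Longrightarrow> U (\<lambda>i. a * x i) = (\<lambda>i. a * U x i)"
  using unitary_linear[of N U x x a 0] by simp

lemma unitary_inner:
  "unitary_op N U \<Longrightarrow> x \<in> ell2 N \<Longrightarrow> y \<in> ell2 N \<Longrightarrow> ell2_inner N (U x) (U y) = ell2_inner N x y"
  by (simp add: unitary_op_def)

lemma unitary_cong:
  assumes "\<And>x. x \<in> ell2 N \<Longrightarrow> U x = U' x"
  shows "unitary_op N U \<longleftrightarrow> unitary_op N U'"
proof -
  have "bij_betw U (ell2 N) (ell2 N) \<longleftrightarrow> bij_betw U' (ell2 N) (ell2 N)"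
    by (rule bij_betw_cong) (rule assms)
  then show ?thesis
    by (simp add: unitary_op_def assms ell2_lincomb)
qed

lemma unitary_comp:
  assumes "unitary_op N U" "unitary_op N W"
  shows "unitary_op N (\<lambda>x. W (U x))"
proof -
  have "bij_betw (W \<circ> U) (ell2 N) (ell2 N)"
    using assms by (auto simp: unitary_op_def intro: bij_betw_trans)
  then show ?thesis
    using assms unitary_ell2[OF assms(1)] by (simp add: unitary_op_def comp_def)
qed

lemma ell2_inner_scale:
  assumes "x \<in> ell2 N" "y \<in> ell2 N"
  shows "ell2_inner N (\<lambda>i. a * x i) (\<lambda>i. b * y i) = a * cnj b * ell2_inner N x y"
proof -
  have "(\<lambda>i. a * cnj b * (x i * cnj (y i))) sums (a * cnj b * ell2_inner N x y)"
    by (intro sums_mult ell2_inner_sums assms)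
  then have "(\<lambda>i. (a * x i) * cnj (b * y i)) sums (a * cnj b * ell2_inner N x y)"
    by (simp add: algebra_simps)
  with ell2_inner_sums[OF ell2_scale[OF assms(1)] ell2_scale[OF assms(2)], of a b] show ?thesis
    using sums_unique2 by blast
qed

lemma unitary_image_multiple_unimodular:
  assumes U: "unitary_op N U" and x: "x \<in> ell2 N" and y: "y \<in> ell2 N"
    and "U x = (\<lambda>i. c * y i)" "ell2_inner N x x = 1" "ell2_inner N y y = 1"
  shows "cmod c = 1"
proof -
  have "c * cnj c = 1"
    using unitary_inner[OF U x x] ell2_inner_scale[OF y y, of c c] assms by simp
  then have "cmod c * cmod c = 1"
    by (metis complex_mod_cnj norm_mult norm_one)
  then show ?thesis
    by (simp add: square_eq_1_iff) (use norm_ge_zero[of c] in linarith)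
qed

text \<open>
  Since \<open>U\<close> is onto, the coordinates of a vector are its inner products with vectors \<open>U z\<close>, and
  these can be moved through the intertwining relation by passing to the adjoint twice.
\<close>

lemma intertwines_adjoint:
  assumes U: "unitary_op N U" and \<alpha>: "cmv_params N \<alpha>" and \<beta>: "cmv_params N \<beta>"
    and T: "\<And>x. x \<in> ell2 N \<Longrightarrow> U (double_layer p \<alpha> x) = double_layer p \<beta> (U x)"
    and y: "y \<in> ell2 N"
  shows "U (double_layer (\<not> p) (\<lambda>n. cnj (\<alpha> n)) y) = double_layer (\<not> p) (\<lambda>n. cnj (\<beta> n)) (U y)"
proof
  fix k
  let ?S = "double_layer (\<not> p) (\<lambda>n. cnj (\<alpha> n))" and ?S' = "double_layer (\<not> p) (\<lambda>n. cnj (\<beta> n))"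
  have mem: "?S y \<in> ell2 N" "U (?S y) \<in> ell2 N" "?S' (U y) \<in> ell2 N" "U y \<in> ell2 N"
    by (intro unitary_ell2[OF U] double_layer_ell2 cmv_params_cnj \<alpha> \<beta> y)+
  show "U (?S y) k = ?S' (U y) k"
  proof (cases "k \<in> idx N")
    case False
    then show ?thesis
      using ell2_zero[OF mem(2)] ell2_zero[OF mem(3)] by simp
  next
    case True
    then have "basis k \<in> ell2 N"
      by (auto simp: idx_def intro: basis_ell2)
    moreover have "U ` ell2 N = ell2 N"
      using U by (simp add: unitary_op_def bij_betw_def)
    ultimately obtain z where z: "z \<in> ell2 N" "U z = basis k"
      by (metis imageE)
    have "U (?S y) k = ell2_inner N (U (?S y)) (U z)"
      using ell2_inner_basis[OF mem(2) True] z by simp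
    also have "\<dots> = ell2_inner N y (double_layer p \<alpha> z)"
      using double_layer_adjoint[OF cmv_params_cnj[OF \<alpha>] y z(1), of "\<not> p"]
      by (simp add: unitary_inner[OF U mem(1) z(1)])
    also have "\<dots> = ell2_inner N (U y) (double_layer p \<beta> (U z))"
      using unitary_inner[OF U y double_layer_ell2[OF \<alpha> z(1), of p]] T[OF z(1)] by simp
    also have "\<dots> = ell2_inner N (?S' (U y)) (U z)"
      using double_layer_adjoint[OF cmv_params_cnj[OF \<beta>] mem(4) unitary_ell2[OF U z(1)], of "\<not> p"]
      by simp
    also have "\<dots> = ?S' (U y) k"
      using ell2_inner_basis[OF mem(3) True] z by simp
    finally show ?thesis .
  qed
qed

section \<open>Defect vectors\<close>

text \<open>
  The product is the identity on all coordinates but the first, so an eigenvector for an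
  eigenvalue other than 1 lives on the first coordinate.
\<close>

lemma defect_eigenvector:
  assumes "cmv_params N \<beta>" "y \<in> ell2 N"
    and "layer False (\<lambda>n. cnj (\<beta> n)) (layer False \<beta> y) = (\<lambda>i. a * y i)" and "a \<noteq> 1"
  shows "y = (\<lambda>i. y 1 * basis 1 i)"
proof
  fix i
  have "(if i = 1 then \<beta> 0 * cnj (\<beta> 0) * y 1 else y i) = a * y i"
    using fun_cong[OF assms(3), of i] fun_cong[OF layer_cnj_layer[OF assms(1,2), of False], of i] by simp
  with \<open>a \<noteq> 1\<close> show "y i = y 1 * basis 1 i"
    by (auto simp: basis_def split: if_splits)
qed

text \<open>
  The vectors \<open>e\<^sub>1\<close> and \<open>g = M\<^sup>* e\<^sub>1\<close> are eigenvectors of \<open>T T\<^sup>* = L L\<^sup>*\<close> and \<open>T\<^sup>* T = M\<^sup>* L\<^sup>* L M\<close> for the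
  eigenvalue \<open>a = \<bar>\<alpha>\<^sub>0\<bar>\<^sup>2 < 1\<close>. Their images are eigenvectors of the corresponding products for \<open>\<beta>\<close>
  with the same eigenvalue, and those eigenspaces are spanned by the defect vectors of \<open>\<beta>\<close>.
\<close>

lemma intertwiner_maps_defect_vectors:
  assumes N: "N \<ge> 1" and \<alpha>: "cmv_params N \<alpha>" and \<beta>: "cmv_params N \<beta>" and U: "unitary_op N U"
    and T: "\<And>x. x \<in> ell2 N \<Longrightarrow> U (double_layer True \<alpha> x) = double_layer True \<beta> (U x)"
  obtains c c' where "cmod c = 1" "U (basis 1) = (\<lambda>i. c * basis 1 i)"
    and "cmod c' = 1"
    and "U (layer True (\<lambda>n. cnj (\<alpha> n)) (basis 1)) = (\<lambda>i. c' * layer True (\<lambda>n. cnj (\<beta> n)) (basis 1) i)"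
proof -
  define a where "a = \<alpha> 0 * cnj (\<alpha> 0)"
  have N1: "enat 1 \<le> N"
    using N by (simp add: one_enat_def)
  then have N0: "enat 0 < N"
    by (simp add: Suc_ile_eq)
  have a: "a \<noteq> 1"
    using rho_nonzero[OF \<alpha> N0] rho_sq[OF \<alpha> less_imp_le[OF N0]] by (auto simp: a_def)
  let ?\<alpha> = "\<lambda>n. cnj (\<alpha> n)" and ?\<beta> = "\<lambda>n. cnj (\<beta> n)"
  let ?g = "layer True ?\<alpha> (basis 1)" and ?h = "layer True ?\<beta> (basis 1)"
  note S = intertwines_adjoint[OF U \<alpha> \<beta> T, simplified]
  have e: "basis 1 \<in> ell2 N"
    using N1 by (rule basis_ell2)
  have mem: "?g \<in> ell2 N" "?h \<in> ell2 N" "U (basis 1) \<in> ell2 N" "U ?g \<in> ell2 N"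
    by (intro unitary_ell2[OF U] layer_ell2 cmv_params_cnj \<alpha> \<beta> e)+
  have inner: "ell2_inner N (basis 1) (basis 1) = 1"
    using ell2_inner_basis[OF e, of 1] N1 by (simp add: idx_def basis_def)
  have inv: "layer True \<gamma> (layer True (\<lambda>n. cnj (\<gamma> n)) x) = x"
       "layer True (\<lambda>n. cnj (\<gamma> n)) (layer True \<gamma> x) = x" 
       if "cmv_params N \<gamma>" "x \<in> ell2 N" for \<gamma> x
    using layer_cnj_layer[OF cmv_params_cnj[OF that(1)] that(2), of True]
      layer_cnj_layer[OF that, of True] by simp_all
  have inner': "ell2_inner N (layer True (\<lambda>n. cnj (\<gamma> n)) (basis 1)) (layer True (\<lambda>n. cnj (\<gamma> n)) (basis 1)) = 1"
    if "cmv_params N \<gamma>" for \<gamma>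
    using layer_adjoint[OF cmv_params_cnj[OF that] e layer_ell2[OF cmv_params_cnj[OF that] e], of True True]
      inv(1)[OF that e] inner by simp
  have LL: "layer False \<alpha> (layer False ?\<alpha> (basis 1)) = (\<lambda>i. a * basis 1 i)"
    "layer False ?\<alpha> (layer False \<alpha> (basis 1)) = (\<lambda>i. a * basis 1 i)"
    using layer_cnj_layer[OF cmv_params_cnj[OF \<alpha>] e, of False] layer_cnj_layer[OF \<alpha> e, of False]
    by (auto simp: a_def basis_def fun_eq_iff)

  define c where "c = U (basis 1) 1"
  \<comment> \<open>the inner pair \<open>M M\<^sup>*\<close> cancels, which leaves \<open>L L\<^sup>*\<close>\<close>
  have "double_layer True \<alpha> (double_layer False ?\<alpha> (basis 1)) = (\<lambda>i. a * basis 1 i)"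
    using inv(1)[OF \<alpha> layer_ell2[OF cmv_params_cnj[OF \<alpha>] e]] LL
    by (simp add: double_layer_def)
  then have "double_layer True \<beta> (double_layer False ?\<beta> (U (basis 1))) = (\<lambda>i. a * U (basis 1) i)"
    using T[OF double_layer_ell2[OF cmv_params_cnj[OF \<alpha>] e, of False]] S[OF e] 
      unitary_scale[OF U e, of a] by simp
  then have "layer False \<beta> (layer False ?\<beta> (U (basis 1))) = (\<lambda>i. a * U (basis 1) i)"
    using inv(1)[OF \<beta> layer_ell2[OF cmv_params_cnj[OF \<beta>] mem(3)]] by (simp add: double_layer_def)
  then have c: "U (basis 1) = (\<lambda>i. c * basis 1 i)"
    unfolding c_def using defect_eigenvector[OF cmv_params_cnj[OF \<beta>] mem(3) _ a] by simp
  then have c1: "cmod c = 1"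
    by (rule unitary_image_multiple_unimodular[OF U e e _ inner inner])

  \<comment> \<open>applying \<open>M\<close> turns the eigenvector \<open>U g\<close> of \<open>M\<^sup>* L\<^sup>* L M\<close> into one of \<open>L\<^sup>* L\<close>\<close>
  define y where "y = layer True \<beta> (U ?g)"
  define c' where "c' = y 1"
  have y: "y \<in> ell2 N"
    unfolding y_def by (intro layer_ell2 \<beta> mem)
  have STg: "double_layer False ?\<alpha> (double_layer True \<alpha> ?g) = (\<lambda>i. a * ?g i)"
    using inv(1)[OF \<alpha> e] LL by (simp add: double_layer_def layer_scale)
  have "double_layer False ?\<beta> (double_layer True \<beta> (U ?g)) =
      U (double_layer False ?\<alpha> (double_layer True \<alpha> ?g))"
    unfolding T[OF mem(1), symmetric] by (rule S[OF double_layer_ell2[OF \<alpha> mem(1)], symmetric])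
  also have "\<dots> = (\<lambda>i. a * U ?g i)"
    unfolding STg by (rule unitary_scale[OF U mem(1)])
  finally have "layer True \<beta> (double_layer False ?\<beta> (double_layer True \<beta> (U ?g))) = (\<lambda>i. a * y i)"
    by (simp add: layer_scale y_def)
  then have "layer False ?\<beta> (layer False \<beta> y) = (\<lambda>i. a * y i)"
    using inv(1)[OF \<beta> layer_ell2[OF cmv_params_cnj[OF \<beta>] layer_ell2[OF \<beta> y]], of False False] 
    by (simp add: double_layer_def y_def)
  then have "y = (\<lambda>i. c' * basis 1 i)"
    unfolding c'_def by (rule defect_eigenvector[OF \<beta> y _ a])
  then have "layer True ?\<beta> y = (\<lambda>i. c' * ?h i)"
    by (simp add: layer_scale)
  then have c': "U ?g = (\<lambda>i. c' * ?h i)"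
    using inv(2)[OF \<beta> mem(4)] by (simp add: y_def)
  then have c'1: "cmod c' = 1"
    by (rule unitary_image_multiple_unimodular[OF U mem(1,2) _ inner'[OF \<alpha>] inner'[OF \<beta>]])
  show ?thesis
    by (rule that[OF c1 c c'1 c'])
qed

section \<open>Rigidity\<close>

text \<open>
  The vector in brackets is the unit vector \<open>v\<close> with coordinates \<open>\<alpha> k, rho \<alpha> k\<close> in the plane of \<open>e\<^sub>k\<close>
  and \<open>e\<^sub>k\<^sub>+\<^sub>1\<close>. As \<open>U\<close> preserves inner products and fixes \<open>e\<^sub>k\<close>, it preserves the coordinate \<open>\<alpha> k\<close>; this
  determines \<open>rho \<alpha> k\<close>, and subtracting the part along \<open>e\<^sub>k\<close> leaves a nonzero multiple of \<open>e\<^sub>k\<^sub>+\<^sub>1\<close>.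
\<close>

lemma next_basis_vector_fixed:
  assumes U: "unitary_op N U" and \<alpha>: "cmv_params N \<alpha>" and \<beta>: "cmv_params N \<beta>"
    and k: "0 < k" "enat k \<le> N" and fix_k: "U (basis k) = basis k"
    and r: "r \<in> ell2 N" "U r = r" and s: "s \<noteq> 0"
    and Ux: "U (\<lambda>i. r i + s * (\<alpha> k * basis k i + rho \<alpha> k * basis (Suc k) i)) =
      (\<lambda>i. r i + s * (\<beta> k * basis k i + rho \<beta> k * basis (Suc k) i))"
  shows "\<alpha> k = \<beta> k" and "enat (Suc k) \<le> N \<Longrightarrow> U (basis (Suc k)) = basis (Suc k)"
proof -
  define v where "v \<gamma> = (\<lambda>i. \<gamma> k * basis k i + rho \<gamma> k * basis (Suc k) i)" for \<gamma>
  have k_idx: "k \<in> idx N"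
    using k by (auto simp: idx_def)
  have v: "v \<gamma> \<in> ell2 N" if \<gamma>: "cmv_params N \<gamma>" for \<gamma>
  proof (cases "enat (Suc k) \<le> N")
    case True
    then show ?thesis
      unfolding v_def using k by (intro ell2_lincomb basis_ell2) auto
  next
    case False
    with k have "enat k = N"
      by (cases N) auto
    then show ?thesis
      using rho_last[OF \<gamma>] ell2_scale[OF basis_ell2[OF k(2)]] by (simp add: v_def)
  qed
  have "(\<lambda>i. r i + s * U (v \<alpha>) i) = U (\<lambda>i. r i + s * v \<alpha> i)"
    using unitary_linear[OF U r(1) v[OF \<alpha>], of 1 s] r(2) by simp
  also have "\<dots> = (\<lambda>i. r i + s * v \<beta> i)"
    unfolding v_def by (rule Ux)
  finally have Uv: "U (v \<alpha>) = v \<beta>"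
    using s by (simp add: fun_eq_iff)
  have "v \<beta> k = ell2_inner N (U (v \<alpha>)) (U (basis k))"
    using ell2_inner_basis[OF v[OF \<beta>] k_idx] by (simp add: Uv fix_k)
  also have "\<dots> = v \<alpha> k"
    using ell2_inner_basis[OF v[OF \<alpha>] k_idx] unitary_inner[OF U v[OF \<alpha>] basis_ell2[OF k(2)]] by simp
  finally show eq: "\<alpha> k = \<beta> k"
    using k by (simp add: v_def basis_def)
  assume k': "enat (Suc k) \<le> N"
  then have "rho \<alpha> k \<noteq> 0"
    by (intro rho_nonzero[OF \<alpha>]) (simp add: Suc_ile_eq)
  moreover have "rho \<alpha> k * U (basis (Suc k)) i = rho \<alpha> k * basis (Suc k) i" for i
  proof -
    have "v \<beta> i = \<alpha> k * U (basis k) i + rho \<alpha> k * U (basis (Suc k)) i"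
      unfolding Uv[symmetric] unfolding v_def
      using unitary_linear[OF U basis_ell2[OF k(2)] basis_ell2[OF k']] by simp
    from this[symmetric] show ?thesis
      by (simp add: v_def fix_k eq rho_def)
  qed
  ultimately show "U (basis (Suc k)) = basis (Suc k)"
    by auto
qed

text \<open>
  An intertwiner that respects the defect vectors exactly has no freedom left: these vectors
  generate the whole space under \<open>T\<close> and \<open>T\<^sup>*\<close>, one basis vector at a time, and each step
  reveals one further parameter.
\<close>

lemma rigidity:
  assumes N: "N \<ge> 1" and \<alpha>: "cmv_params N \<alpha>" and \<beta>: "cmv_params N \<beta>" and U: "unitary_op N U"
    and T: "\<And>x. x \<in> ell2 N \<Longrightarrow> U (double_layer True \<alpha> x) = double_layer True \<beta> (U x)"
    and e1: "U (basis 1) = basis 1"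
    and g: "U (layer True (\<lambda>n. cnj (\<alpha> n)) (basis 1)) = layer True (\<lambda>n. cnj (\<beta> n)) (basis 1)"
    and n: "enat n \<le> N"
  shows "\<alpha> n = \<beta> n"
proof -
  have N1: "enat 1 \<le> N"
    using N by (simp add: one_enat_def)
  have e: "basis 1 \<in> ell2 N"
    using N1 by (rule basis_ell2)
  have U0: "U (\<lambda>i. 0) = (\<lambda>i. 0)"
    using unitary_scale[OF U e, of 0] by simp
  have inv: "layer True \<gamma> (layer True (\<lambda>n. cnj (\<gamma> n)) (basis 1)) = basis 1" if "cmv_params N \<gamma>" for \<gamma>
    using layer_cnj_layer[OF cmv_params_cnj[OF that] e, of True] by simp
  have Tg: "double_layer True \<gamma> (layer True (\<lambda>n. cnj (\<gamma> n)) (basis 1)) = (\<lambda>i. - \<gamma> 0 * basis 1 i)"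
    if "cmv_params N \<gamma>" for \<gamma>
    unfolding double_layer_def inv[OF that] by (simp add: layer_basis)
  have \<alpha>\<beta>0: "\<alpha> 0 = \<beta> 0"
  proof -
    have "(\<lambda>i. - \<alpha> 0 * U (basis 1) i) =
        U (double_layer True \<alpha> (layer True (\<lambda>n. cnj (\<alpha> n)) (basis 1)))"
      using unitary_scale[OF U e, of "- \<alpha> 0"] by (simp only: Tg[OF \<alpha>])
    also have "\<dots> = (\<lambda>i. - \<beta> 0 * basis 1 i)"
      using T[OF layer_ell2[OF cmv_params_cnj[OF \<alpha>] e]] by (simp only: g Tg[OF \<beta>])
    finally have "(\<lambda>i. - \<alpha> 0 * U (basis 1) i) = (\<lambda>i. - \<beta> 0 * basis 1 i)" .
    from fun_cong[OF this, of 1] show ?thesis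
      unfolding e1 by (simp add: basis_def)
  qed
  have step: "\<alpha> k = \<beta> k \<and> (enat (Suc k) \<le> N \<longrightarrow> U (basis (Suc k)) = basis (Suc k))"
    if k: "0 < k" "enat k \<le> N" and fixed: "\<And>m. m \<le> k \<Longrightarrow> U (basis m) = basis m"
      and eq: "\<And>m. m < k \<Longrightarrow> \<alpha> m = \<beta> m" for k
  proof (cases "k = 1")
    case True
    have "(\<lambda>i. 0) \<in> ell2 N"
      using ell2_scale[OF e, of 0] by simp
    with next_basis_vector_fixed[OF U \<alpha> \<beta> k fixed[of k], of "\<lambda>i. 0" 1] show ?thesis
      using g U0 by (auto simp: layer_basis True)
  next
    case False
    define j where "j = k - 1"
    have j: "k = Suc j" "0 < j"
      using False k by (auto simp: j_def)
    have jN: "enat j < N" "enat j \<le> N" "enat (j - 1) \<le> N"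
      using k j order_trans[of "enat (j - 1)" "enat j" N] by (auto simp: Suc_ile_eq less_imp_le)
    \<comment> \<open>odd \<open>j\<close> uses \<open>T\<close>, even \<open>j\<close> its adjoint; either way column \<open>j\<close> reaches down to row \<open>j + 2\<close>\<close>
    define \<gamma> where "\<gamma> = (if odd j then \<alpha> else (\<lambda>n. cnj (\<alpha> n)))"
    define \<delta> where "\<delta> = (if odd j then \<beta> else (\<lambda>n. cnj (\<beta> n)))"
    have \<gamma>: "cmv_params N \<gamma>" and \<delta>: "cmv_params N \<delta>"
      using \<alpha> \<beta> by (auto simp: \<gamma>_def \<delta>_def cmv_params_cnj)
    have \<gamma>\<delta>: "\<gamma> m = \<delta> m" if "m < k" for m
      using eq[OF that] by (simp add: \<gamma>_def \<delta>_def)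
    have W: "U (double_layer (odd j) \<gamma> x) = double_layer (odd j) \<delta> (U x)" if "x \<in> ell2 N" for x
      using T[OF that] intertwines_adjoint[OF U \<alpha> \<beta> T that] by (cases "odd j") (auto simp: \<gamma>_def \<delta>_def)
    \<comment> \<open>the part of column \<open>j\<close> that depends on parameters below \<open>k\<close> only\<close>
    define r where "r = (\<lambda>i. cnj (\<gamma> j) * rho \<gamma> (j - 1) * basis (j - 1) i +
      (- cnj (\<gamma> j) * \<gamma> (j - 1)) * basis j i)"
    have b: "basis j \<in> ell2 N" "basis (j - 1) \<in> ell2 N"
      using jN by (auto intro: basis_ell2)
    have r: "r \<in> ell2 N" "U r = r"
    proof -
      show "r \<in> ell2 N"
        unfolding r_def by (intro ell2_lincomb b)
      have "U (basis j) = basis j" "U (basis (j - 1)) = basis (j - 1)"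
        using fixed j by auto
      then show "U r = r"
        unfolding r_def unitary_linear[OF U b(2,1)] by simp
    qed
    have W\<gamma>: "double_layer (odd j) \<gamma> (basis j) =
      (\<lambda>i. r i + rho \<gamma> j * (cnj (\<gamma> k) * basis k i + rho \<gamma> k * basis (Suc k) i))"
      using double_layer_basis[OF j(2) refl, of \<gamma>] by (simp add: r_def j(1) algebra_simps)
    have "rho \<delta> j = rho \<gamma> j" "rho \<delta> (j - 1) = rho \<gamma> (j - 1)"
      using \<gamma>\<delta>[of j] \<gamma>\<delta>[of "j - 1"] j by (auto simp: rho_def)
    then have W\<delta>: "double_layer (odd j) \<delta> (basis j) =
      (\<lambda>i. r i + rho \<gamma> j * (cnj (\<delta> k) * basis k i + rho \<delta> k * basis (Suc k) i))"
      using double_layer_basis[OF j(2) refl, of \<delta>] \<gamma>\<delta>[of j] \<gamma>\<delta>[of "j - 1"] j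
      by (simp add: r_def algebra_simps)
    have "U (\<lambda>i. r i + rho \<gamma> j * (cnj (\<gamma> k) * basis k i + rho \<gamma> k * basis (Suc k) i)) =
      (\<lambda>i. r i + rho \<gamma> j * (cnj (\<delta> k) * basis k i + rho \<delta> k * basis (Suc k) i))"
      using W[OF b(1)] fixed[of j] j unfolding W\<gamma>[symmetric] W\<delta>[symmetric] by simp
    with next_basis_vector_fixed[OF U cmv_params_cnj[OF \<gamma>] cmv_params_cnj[OF \<delta>] k fixed[of k] r
        rho_nonzero[OF \<gamma> jN(1)]]
    show ?thesis
      by (auto simp: \<gamma>_def \<delta>_def split: if_splits)
  qed
  have ind: "(\<forall>m\<le>Suc k. U (basis m) = basis m) \<and> (\<forall>m<Suc k. \<alpha> m = \<beta> m)" if "enat (Suc k) \<le> N" for k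
    using that
  proof (induction k)
    case 0
    show ?case
      using e1 U0 \<alpha>\<beta>0 by (auto simp: le_Suc_eq)
  next
    case (Suc k)
    then have "enat (Suc k) \<le> N"
      using order_trans[of "enat (Suc k)" "enat (Suc (Suc k))" N] by simp
    with Suc step[of "Suc k"] show ?case
      by (auto simp: le_Suc_eq less_Suc_eq)
  qed
  show ?thesis
  proof (cases n)
    case 0
    then show ?thesis using \<alpha>\<beta>0 by simp
  next
    case (Suc k)
    then show ?thesis
      using ind[of k] step[of n] n by auto
  qed
qed

section \<open>Rotating the parameters\<close>

text \<open>
  For \<open>s = 1\<close> this is \<open>diag (\<mu>, 1, \<mu>, 1, \<dots>)\<close>. The scalar \<open>s\<close>, which commutes with every linear operator,
  serves to normalise an intertwiner.
\<close>

definition twist :: "complex \<Rightarrow> complex \<Rightarrow> (nat \<Rightarrow> complex) \<Rightarrow> nat \<Rightarrow> complex" where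
  "twist s \<mu> x i = s * (if odd i then \<mu> else 1) * x i"

lemma unimodular_cnj: "cmod a = 1 \<Longrightarrow> a * cnj a = 1"
  using complex_norm_square[of a] by simp

lemma twist_ell2: 
  assumes "x \<in> ell2 N" "cmod s = 1" "cmod \<mu> = 1"
  shows "twist s \<mu> x \<in> ell2 N"
proof -
  have "cmod (twist s \<mu> x i) = cmod (x i)" for i
    using assms by (simp add: twist_def norm_mult)
  with assms(1) show ?thesis
    by (auto simp: ell2_iff twist_def)
qed

lemma twist_unitary:
  assumes "cmod s = 1" "cmod \<mu> = 1"
  shows "unitary_op N (twist s \<mu>)"
proof -
  define d where "d i = s * (if odd i then \<mu> else 1)" for i :: nat
  have d: "d i * cnj (d i) = 1" for i
    by (rule unimodular_cnj) (simp add: d_def norm_mult assms)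
  have tw: "twist s \<mu> x i = d i * x i" "twist (cnj s) (cnj \<mu>) x i = cnj (d i) * x i" for x i
    by (simp_all add: twist_def d_def)
  have "twist s \<mu> (twist (cnj s) (cnj \<mu>) x) i = (d i * cnj (d i)) * x i"
    "twist (cnj s) (cnj \<mu>) (twist s \<mu> x) i = (d i * cnj (d i)) * x i" for x i
    by (simp_all add: tw)
  then have inv: "twist s \<mu> (twist (cnj s) (cnj \<mu>) x) = x" "twist (cnj s) (cnj \<mu>) (twist s \<mu> x) = x" for x
    unfolding d by auto
  have bij: "bij_betw (twist s \<mu>) (ell2 N) (ell2 N)"
    by (rule bij_betwI[where g = "twist (cnj s) (cnj \<mu>)"])
      (use assms in \<open>auto simp: inv intro!: twist_ell2\<close>)
  have "twist s \<mu> x i * cnj (twist s \<mu> y i) = (d i * cnj (d i)) * (x i * cnj (y i))" for x y i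
    by (simp add: tw)
  then have "ell2_inner N (twist s \<mu> x) (twist s \<mu> y) = ell2_inner N x y" for x y
    by (simp only: ell2_inner_def d mult_1)
  moreover have "twist s \<mu> (\<lambda>i. a * x i + b * y i) = (\<lambda>i. a * twist s \<mu> x i + b * twist s \<mu> y i)" for a b x y
    by (auto simp: twist_def algebra_simps)
  ultimately show ?thesis
    using bij by (simp add: unitary_op_def)
qed

lemma cmv_params_rotate:
  "cmv_params N \<alpha> \<Longrightarrow> cmod \<mu> = 1 \<Longrightarrow> cmv_params N (\<lambda>n. \<mu> * \<alpha> n)"
  by (auto simp: cmv_params_def norm_mult)

text \<open>
  A single layer is not conjugated into a layer: the first layer turns \<open>diag (\<mu>, 1, \<mu>, 1, \<dots>)\<close>
  into \<open>diag (1, \<mu>, 1, \<mu>, \<dots>)\<close>, called \<open>W\<close> below (up to the scalar \<open>s\<close>), and the second layer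
  turns it back.
\<close>

lemma twist_double_layer:
  assumes "cmod \<mu> = 1"
  shows "double_layer True (\<lambda>n. \<mu> * \<alpha> n) (twist s \<mu> x) = twist s \<mu> (double_layer True \<alpha> x)"
proof -
  have r: "rho (\<lambda>n. \<mu> * \<alpha> n) = rho \<alpha>"
    using assms by (simp add: rho_def norm_mult fun_eq_iff)
  have u: "\<mu> * (cnj \<mu> * z) = z" for z
    using unimodular_cnj[OF assms] by (simp add: mult.assoc[symmetric])
  define W where "W x i = s * (if even i then \<mu> else 1) * x i" for x :: "nat \<Rightarrow> complex" and i
  have 1: "layer True (\<lambda>n. \<mu> * \<alpha> n) (twist s \<mu> x) = W (layer True \<alpha> x)"
    by (auto simp: fun_eq_iff layer_def r twist_def W_def u algebra_simps)
  have 2: "layer False (\<lambda>n. \<mu> * \<alpha> n) (W z) = twist s \<mu> (layer False \<alpha> z)" if "z 0 = 0" for z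
  proof
    fix i
    show "layer False (\<lambda>n. \<mu> * \<alpha> n) (W z) i = twist s \<mu> (layer False \<alpha> z) i"
      by (auto simp: layer_def r twist_def W_def u algebra_simps that)
  qed
  show ?thesis
    using 1 2[of "layer True \<alpha> x"] by (simp add: double_layer_def layer_def)
qed

section \<open>Unitary equivalence\<close>

lemma diag_V_eq_twist:
  assumes x: "x \<in> ell2 N"
  shows "mat_op N (diag_V t) x = twist 1 (cis t) x"
proof
  fix i
  have "(\<Sum>\<^sub>\<infinity>j\<in>idx N. diag_V t i j * x j) = (\<Sum>\<^sub>\<infinity>j\<in>{i}. diag_V t i j * x j)" if "i \<in> idx N"
    by (rule infsum_cong_neutral) (use that in \<open>auto simp: diag_V_def\<close>)
  then show "mat_op N (diag_V t) x i = twist 1 (cis t) x i"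
    using ell2_zero[OF x, of i] by (simp add: mat_op_def twist_def diag_V_def)
qed

lemma truncated_cmv_eq_double_layer:
  "cmv_params N \<alpha> \<Longrightarrow> x \<in> ell2 N \<Longrightarrow> mat_op N (truncated_cmv \<alpha>) x = double_layer True \<alpha> x"
  by (simp add: truncated_cmv_eq_layers double_layer_def)

lemma truncated_cmv_cong:
  assumes "\<And>n. enat n \<le> N \<Longrightarrow> \<alpha> n = \<beta> n"
  shows "mat_op N (truncated_cmv \<alpha>) x = mat_op N (truncated_cmv \<beta>) x"
proof -
  have eq: "\<alpha> n = \<beta> n" "rho \<alpha> n = rho \<beta> n" if "n \<le> m" "m \<in> idx N" for n m
  proof -
    have "enat n \<le> N"
      using that order_trans[of "enat n" "enat m" N] by (auto simp: idx_def)
    then show "\<alpha> n = \<beta> n" "rho \<alpha> n = rho \<beta> n"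
      by (simp_all add: assms rho_def)
  qed
  have "truncated_cmv \<alpha> i j = truncated_cmv \<beta> i j" if "i \<in> idx N" "j \<in> idx N" for i j
    using eq[OF _ that(1)] eq[OF _ that(2)] by (auto simp: truncated_cmv_def)
  then show ?thesis
    by (auto simp: mat_op_def fun_eq_iff intro!: infsum_cong)
qed

text \<open>
  With \<open>U e\<^sub>1 = c e\<^sub>1\<close> and \<open>U g\<^sub>\<alpha> = c' g\<^sub>\<beta>\<close>, composing \<open>U\<close> with the twist by \<open>cnj \<mu>\<close>, \<open>\<mu> = c cnj c'\<close>, scaled
  by \<open>cnj c'\<close>, produces an intertwiner \<open>W\<close> between the parameters \<open>\<alpha>\<close> and \<open>cnj \<mu> \<beta>\<close> that
  maps each defect vector exactly to its counterpart, so that \<open>rigidity\<close> applies.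
\<close>

lemma unitarily_equivalent_imp_rotation:
  assumes N: "N \<ge> 1" and \<alpha>: "cmv_params N \<alpha>" and \<beta>: "cmv_params N \<beta>"
    and eqv: "unitarily_equivalent N (truncated_cmv \<alpha>) (truncated_cmv \<beta>)"
  shows "\<exists>t\<in>{0..<2*pi}. \<forall>n. enat n \<le> N \<longrightarrow> \<beta> n = cis t * \<alpha> n"
proof -
  obtain U where U: "unitary_op N U"
    and UT: "\<And>x. x \<in> ell2 N \<Longrightarrow>
      U (mat_op N (truncated_cmv \<alpha>) (inv_into (ell2 N) U x)) = mat_op N (truncated_cmv \<beta>) x"
    using eqv by (auto simp: unitarily_equivalent_def)
  have T: "U (double_layer True \<alpha> x) = double_layer True \<beta> (U x)" if x: "x \<in> ell2 N" for x
  proof -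
    have "inv_into (ell2 N) U (U x) = x"
      using U x by (auto simp: unitary_op_def bij_betw_def)
    then show ?thesis
      using UT[OF unitary_ell2[OF U x]] 
      by (simp add: truncated_cmv_eq_double_layer \<alpha> \<beta> x unitary_ell2[OF U x])
  qed
  obtain c c' where c: "cmod c = 1" "U (basis 1) = (\<lambda>i. c * basis 1 i)"
    and c': "cmod c' = 1" "U (layer True (\<lambda>n. cnj (\<alpha> n)) (basis 1)) =
      (\<lambda>i. c' * layer True (\<lambda>n. cnj (\<beta> n)) (basis 1) i)"
    by (rule intertwiner_maps_defect_vectors[OF N \<alpha> \<beta> U T])
  define \<mu> where "\<mu> = c * cnj c'"
  have \<mu>: "cmod \<mu> = 1" "cmod (cnj \<mu>) = 1" "cmod (cnj c') = 1"
    using c c' by (simp_all add: \<mu>_def norm_mult)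
  define W where "W x = twist (cnj c') (cnj \<mu>) (U x)" for x
  have W: "unitary_op N W"
    unfolding W_def by (rule unitary_comp[OF U twist_unitary[OF \<mu>(3,2)]])
  have cc: "c * cnj c = 1" "c' * cnj c' = 1"
    using c c' by (simp_all add: unimodular_cnj)
  have WT: "W (double_layer True \<alpha> x) = double_layer True (\<lambda>n. cnj \<mu> * \<beta> n) (W x)" if "x \<in> ell2 N" for x
    by (simp add: W_def T[OF that] twist_double_layer[OF \<mu>(2)])
  have We: "W (basis 1) = basis 1"
  proof
    fix i
    have "W (basis 1) i = (c * cnj c) * (c' * cnj c') * basis 1 i"
      unfolding W_def c(2) by (simp add: twist_def \<mu>_def basis_def)
    then show "W (basis 1) i = basis 1 i"
      by (simp only: cc) simp
  qed
  have Wg: "W (layer True (\<lambda>n. cnj (\<alpha> n)) (basis 1)) =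
      layer True (\<lambda>n. cnj (cnj \<mu> * \<beta> n)) (basis 1)"
  proof
    fix i
    let ?h = "layer True (\<lambda>n. cnj (\<beta> n)) (basis 1)" and ?h' = "layer True (\<lambda>n. cnj (cnj \<mu> * \<beta> n)) (basis 1)"
    have r: "rho (\<lambda>n. \<mu> * cnj (\<beta> n)) = rho \<beta>"
      using \<mu>(1) by (simp add: rho_def norm_mult fun_eq_iff)
    have "W (layer True (\<lambda>n. cnj (\<alpha> n)) (basis 1)) i = (c' * cnj c') * ((if odd i then cnj \<mu> else 1) * ?h i)"
      unfolding W_def c'(2) by (simp add: twist_def)
    also have "\<dots> = (if odd i then cnj \<mu> else 1) * ?h i"
      by (simp only: cc) simp
    also have "\<dots> = ?h' i"
      by (auto simp: layer_basis r basis_def)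
    finally show "W (layer True (\<lambda>n. cnj (\<alpha> n)) (basis 1)) i = ?h' i" .
  qed
  have eq: "\<beta> n = \<mu> * \<alpha> n" if "enat n \<le> N" for n
  proof -
    have "\<mu> * \<alpha> n = (\<mu> * cnj \<mu>) * \<beta> n"
      using rigidity[OF N \<alpha> cmv_params_rotate[OF \<beta> \<mu>(2)] W WT We Wg that] by simp
    then show ?thesis
      using unimodular_cnj[OF \<mu>(1)] by simp
  qed
  have "\<mu> = cis (Arg2pi \<mu>)"
    using Arg2pi_eq[of \<mu>] \<mu>(1) by (simp add: cis_conv_exp)
  moreover have "Arg2pi \<mu> \<in> {0..<2*pi}"
    using Arg2pi_ge_0[of \<mu>] Arg2pi_lt_2pi[of \<mu>] by simp
  ultimately show ?thesis
    using eq by metis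
qed

lemma diag_V_conjugates:
  assumes \<alpha>: "cmv_params N \<alpha>"
  shows "unitary_op N (mat_op N (diag_V t))"
    and "x \<in> ell2 N \<Longrightarrow>
      mat_op N (diag_V t)
        (mat_op N (truncated_cmv \<alpha>) (inv_into (ell2 N) (mat_op N (diag_V t)) x)) =
      mat_op N (truncated_cmv (\<lambda>n. cis t * \<alpha> n)) x"
proof -
  let ?V = "mat_op N (diag_V t)"
  show V: "unitary_op N ?V"
    using twist_unitary[of 1 "cis t" N] unitary_cong[OF diag_V_eq_twist] by simp
  assume x: "x \<in> ell2 N"
  define z where "z = inv_into (ell2 N) ?V x"
  have "x \<in> ?V ` ell2 N"
    using V x by (simp add: unitary_op_def bij_betw_def)
  then have z: "z \<in> ell2 N" "?V z = x"
    unfolding z_def by (rule inv_into_into, rule f_inv_into_f)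
  then have "twist 1 (cis t) z = x"
    by (simp add: diag_V_eq_twist)
  then have "?V (mat_op N (truncated_cmv \<alpha>) z) = double_layer True (\<lambda>n. cis t * \<alpha> n) x"
    using twist_double_layer[of "cis t" \<alpha> 1 z]
    by (simp add: diag_V_eq_twist truncated_cmv_eq_double_layer double_layer_ell2 \<alpha> z)
  also have "\<dots> = mat_op N (truncated_cmv (\<lambda>n. cis t * \<alpha> n)) x"
    by (simp add: truncated_cmv_eq_double_layer cmv_params_rotate \<alpha> x)
  finally show "?V (mat_op N (truncated_cmv \<alpha>) (inv_into (ell2 N) ?V x)) =
      mat_op N (truncated_cmv (\<lambda>n. cis t * \<alpha> n)) x"
    by (simp add: z_def)
qed

theorem proposition6p2:
  fixes N :: enat and \<alpha> \<beta> :: "nat \<Rightarrow> complex"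
  assumes "N \<ge> 1" and "cmv_params N \<alpha>" and "cmv_params N \<beta>"
  shows "(unitarily_equivalent N (truncated_cmv \<alpha>) (truncated_cmv \<beta>) \<longleftrightarrow>
            (\<exists>t\<in>{0..<2*pi}. \<forall>n. enat n \<le> N \<longrightarrow> \<beta> n = cis t * \<alpha> n)) \<and>
         (\<forall>t\<in>{0..<2*pi}.
            unitary_op N (mat_op N (diag_V t)) \<and>
            (\<forall>x\<in>ell2 N.
               mat_op N (diag_V t)
                 (mat_op N (truncated_cmv \<alpha>) (inv_into (ell2 N) (mat_op N (diag_V t)) x)) =
               mat_op N (truncated_cmv (\<lambda>n. cis t * \<alpha> n)) x))"
proof -
  have "unitarily_equivalent N (truncated_cmv \<alpha>) (truncated_cmv \<beta>)"
    if "\<forall>n. enat n \<le> N \<longrightarrow> \<beta> n = cis t * \<alpha> n" for t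
  proof -
    have "mat_op N (truncated_cmv (\<lambda>n. cis t * \<alpha> n)) x = mat_op N (truncated_cmv \<beta>) x" for x
      by (rule truncated_cmv_cong) (use that in simp)
    with diag_V_conjugates[OF assms(2), where t = t] show ?thesis
      unfolding unitarily_equivalent_def by metis
  qed
  with unitarily_equivalent_imp_rotation[OF assms] diag_V_conjugates[OF assms(2)] show ?thesis
    by blast
qed

end
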